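(* Let $G=(V,E)$ be a connected finite graph with vertex measure $\mu:V\to(0,+\infty)$ and symmetric edge measure $\omega:E\to(0,+\infty)$, and let $h\in C(V)$ satisfy $\overline{h}<0$. Let $c_-(h)\in[-\infty,0)$ be the critical constant of the Kazdan-Warner equation $\Delta u=c-he^u$ in the case $c<0$. Then: (1) if $c_-(h)=-\infty$, then $h\leq 0$ on $V$ and $h\not\equiv 0$; (2) if $c_-(h)>-\infty$, then there exists at least one $u\in C(V)$ with $\Delta u=c_-(h)-he^{u}$ on $V$.
   Context: $C(V)$ is the set of real functions on $V$. The graph Laplacian $\Delta:C(V)\to C(V)$ is $\Delta f_i=\frac{1}{\mu_i}\sum_{j\sim i}\omega_{ij}(f_j-f_i)$ for $i\in V$, where $j\sim i$ means that $j$ is adjacent to $i$. The average of $f\in C(V)$ is $\overline{f}=\left(\sum_{i\in V}\mu_i f_i\right)/\left(\sum_{i\in V}\mu_i\right)$. For $c\in\mathbb{R}$ and $h\in C(V)$, a solution of the Kazdan-Warner equation $\Delta u=c-he^u$ is a function $u\in C(V)$ with $\Delta u_i=c-h_ie^{u_i}$ for all $i\in V$. Definition of $c_-(h)$: it is known (Grigor'yan, Lin and Yang) that if $\overline{h}<0$, then there is a constant $c_-(h)$, with $-\infty\leq c_-(h)<0$, depending only on $h$ (for the fixed weighted graph) such that $\Delta u=c-he^u$ has a solution for every $c\in(c_-(h),0)$ and has no solution for any $c<c_-(h)$. These properties determine $c_-(h)$; equivalently, $c_-(h)$ is the infimum of all $c<0$ for which the equation has a solution. *)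

theory Defs
  imports "HOL-Analysis.Analysis" "Graph_Theory.Digraph_Component"
begin

text \<open>
  An undirected graph without parallel edges is a symmetric set of arcs over \<open>pverts G\<close>. A function
  on the vertex set is an HOL function on the ambient type, of which only the values on \<open>pverts G\<close>
  are used.
\<close>

definition laplacian ::
  "'a pair_pre_digraph \<Rightarrow> ('a \<Rightarrow> real) \<Rightarrow> ('a \<Rightarrow> 'a \<Rightarrow> real) \<Rightarrow> ('a \<Rightarrow> real) \<Rightarrow> 'a \<Rightarrow> real" where
  "laplacian G \<mu> \<omega> f i = 1 / \<mu> i * (\<Sum>j \<in> {j. (i, j) \<in> parcs G}. \<omega> i j * (f j - f i))"

definition graph_average :: "'a pair_pre_digraph \<Rightarrow> ('a \<Rightarrow> real) \<Rightarrow> ('a \<Rightarrow> real) \<Rightarrow> real" where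
  "graph_average G \<mu> f = (\<Sum>i\<in>pverts G. \<mu> i * f i) / (\<Sum>i\<in>pverts G. \<mu> i)"

definition kazdan_warner_solution ::
  "'a pair_pre_digraph \<Rightarrow> ('a \<Rightarrow> real) \<Rightarrow> ('a \<Rightarrow> 'a \<Rightarrow> real) \<Rightarrow> ('a \<Rightarrow> real) \<Rightarrow> real
    \<Rightarrow> ('a \<Rightarrow> real) \<Rightarrow> bool" where
  "kazdan_warner_solution G \<mu> \<omega> h c u \<longleftrightarrow>
     (\<forall>i\<in>pverts G. laplacian G \<mu> \<omega> u i = c - h i * exp (u i))"

definition is_critical_constant ::
  "'a pair_pre_digraph \<Rightarrow> ('a \<Rightarrow> real) \<Rightarrow> ('a \<Rightarrow> 'a \<Rightarrow> real) \<Rightarrow> ('a \<Rightarrow> real) \<Rightarrow> ereal \<Rightarrow> bool" where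
  "is_critical_constant G \<mu> \<omega> h C \<longleftrightarrow>
     C < 0 \<and>
     (\<forall>c::real. C < ereal c \<and> c < 0 \<longrightarrow> (\<exists>u. kazdan_warner_solution G \<mu> \<omega> h c u)) \<and>
     (\<forall>c::real. ereal c < C \<longrightarrow> \<not> (\<exists>u. kazdan_warner_solution G \<mu> \<omega> h c u))"

text \<open>
  The properties in \<open>is_critical_constant\<close> hold for at most one \<open>C\<close>, by the next lemma. That such a
  \<open>C\<close> exists when the average of \<open>h\<close> is negative is a theorem of Grigor'yan, Lin and Yang.
\<close>

lemma is_critical_constant_unique:
  assumes "is_critical_constant G \<mu> \<omega> h C" and "is_critical_constant G \<mu> \<omega> h D"
  shows "C = D"
proof -
  have *: "\<not> A < B" if A: "is_critical_constant G \<mu> \<omega> h A" and B: "is_critical_constant G \<mu> \<omega> h B" for A B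
  proof
    assume "A < B"
    then obtain c where c: "A < ereal c" "ereal c < B"
      using ereal_dense2 by blast
    moreover have "c < 0"
    proof -
      have "ereal c < 0"
        using c(2) B less_trans unfolding is_critical_constant_def by blast
      then show ?thesis by simp
    qed
    ultimately show False
      using A B unfolding is_critical_constant_def by blast
  qed
  show ?thesis
    using *[OF assms] *[OF assms(2,1)] by (simp add: not_less order_antisym)
qed

definition c_minus ::
  "'a pair_pre_digraph \<Rightarrow> ('a \<Rightarrow> real) \<Rightarrow> ('a \<Rightarrow> 'a \<Rightarrow> real) \<Rightarrow> ('a \<Rightarrow> real) \<Rightarrow> ereal" where
  "c_minus G \<mu> \<omega> h = (THE C. is_critical_constant G \<mu> \<omega> h C)"

end

theory Submission
  imports Defs
begin

text \<open>
  For \<open>c < 0\<close> very negative constants are subsolutions, so the equation is solvable as soon as it has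
  a supersolution; in particular the solvable \<open>c < 0\<close> form an up-set. If \<open>\<Delta> v + h < 0\<close>, then
  \<open>a v + ln a\<close> with small \<open>a > 0\<close> is a supersolution for \<open>c\<close> near 0, and if moreover \<open>h \<le> 0\<close>, then
  some \<open>a v + b\<close> is one for any given \<open>c < 0\<close>.

  Looking at a minimum of a solution gives \<open>u \<ge> ln (-c / max \<bar>h\<bar>)\<close>. At a vertex with \<open>h i > 0\<close> the
  equation then bounds \<open>exp (u i)\<close> by an affine function of \<open>u i\<close>. This is impossible for very
  negative \<open>c\<close>, and for \<open>c\<close> near a finite critical constant it bounds \<open>u\<close> at that vertex, hence on the
  whole connected graph, so solutions converge along a subsequence.
\<close>

section \<open>Compactness on finite sets and growth of the exponential\<close>

text \<open>Bolzano-Weierstrass, applied to one point of \<open>A\<close> after another with nested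
  subsequences.\<close>

lemma finite_pointwise_bounded_convergent_subseq:
  fixes u :: "nat \<Rightarrow> 'a \<Rightarrow> real"
  assumes "finite A" and "\<And>n i. i \<in> A \<Longrightarrow> a i \<le> u n i \<and> u n i \<le> b i"
  obtains r l where "strict_mono r" and "\<And>i. i \<in> A \<Longrightarrow> (\<lambda>n. u (r n) i) \<longlonglongrightarrow> l i"
proof -
  have "\<exists>r l. strict_mono r \<and> (\<forall>i\<in>A. (\<lambda>n. u (r n) i) \<longlonglongrightarrow> l i)"
    using assms
  proof (induction A)
    case empty
    show ?case by (rule exI[of _ id]) (simp add: strict_mono_def)
  next
    case (insert x A)
    then obtain r l where r: "strict_mono r" "\<forall>i\<in>A. (\<lambda>n. u (r n) i) \<longlonglongrightarrow> l i"
      by blast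
    have "\<forall>n. u (r n) x \<in> {a x..b x}"
      using insert.prems by auto
    then obtain y s where s: "strict_mono s" "((\<lambda>n. u (r n) x) \<circ> s) \<longlonglongrightarrow> y"
      using compact_Icc[of "a x" "b x"] unfolding compact_eq_seq_compact_metric seq_compact_def
      by meson
    have "(\<lambda>n. u ((r \<circ> s) n) i) \<longlonglongrightarrow> (if i = x then y else l i)" if "i \<in> insert x A" for i
    proof (cases "i = x")
      case True
      then show ?thesis using s(2) by (simp add: o_def)
    next
      case False
      then have "((\<lambda>n. u (r n) i) \<circ> s) \<longlonglongrightarrow> l i"
        using that r(2) s(1) by (intro LIMSEQ_subseq_LIMSEQ) auto
      then show ?thesis using False by (simp add: o_def)
    qed
    moreover have "strict_mono (r \<circ> s)"
      using r(1) s(1) by (rule strict_mono_o)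
    ultimately show ?case
      by (intro exI[of _ "r \<circ> s"] exI[of _ "\<lambda>i. if i = x then y else l i"]) (simp add: o_def)
  qed
  then obtain r l where "strict_mono r" "\<forall>i\<in>A. (\<lambda>n. u (r n) i) \<longlonglongrightarrow> l i"
    by (elim exE conjE)
  then show thesis by (intro that[of r l]) auto
qed

text \<open>The tangent to the convex function \<open>p * exp t\<close> at the point of slope
  \<open>d + 1\<close> lies below its graph. The slope exceeds \<open>d\<close> by one so that a
  bound of \<open>p * exp t\<close> by \<open>d * t\<close> plus a constant leaves an upper bound
  for \<open>t\<close>.\<close>

lemma exp_dominates_linear:
  fixes p d :: real
  assumes "p > 0" and "d \<ge> 0"
  obtains k where "\<And>t. p * exp t \<ge> d * t + t - k"
proof
  fix t :: real
  define s where "s = ln ((d + 1) / p)"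
  have "p * exp s = d + 1"
    using assms by (simp add: s_def)
  then have "p * exp t = (d + 1) * exp (t - s)"
    by (metis (no_types) exp_add add.commute diff_add_cancel mult.assoc)
  also have "\<dots> \<ge> (d + 1) * (1 + (t - s))"
    using assms exp_ge_add_one_self[of "t - s"] by (intro mult_left_mono) auto
  finally show "p * exp t \<ge> d * t + t - ((d + 1) * (ln ((d + 1) / p) - 1))"
    by (simp add: s_def algebra_simps)
qed

section \<open>The Laplacian of a connected weighted graph\<close>

locale weighted_graph = pair_pseudo_graph G
  for G :: "'a pair_pre_digraph" and \<mu> :: "'a \<Rightarrow> real" and \<omega> :: "'a \<Rightarrow> 'a \<Rightarrow> real" +
  assumes connected: "Digraph_Component.connected (with_proj G)"
    and measure_pos: "i \<in> pverts G \<Longrightarrow> \<mu> i > 0"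
    and weight_pos: "(i, j) \<in> parcs G \<Longrightarrow> \<omega> i j > 0"
    and weight_sym: "(i, j) \<in> parcs G \<Longrightarrow> \<omega> i j = \<omega> j i"
begin

abbreviation "V \<equiv> pverts G"
abbreviation "nbrs i \<equiv> {j. (i, j) \<in> parcs G}"
abbreviation "\<Delta> \<equiv> laplacian G \<mu> \<omega>"

definition wdegree :: "'a \<Rightarrow> real" where
  "wdegree i = (\<Sum>j\<in>nbrs i. \<omega> i j) / \<mu> i"

lemma finite_V: "finite V"
  by (rule pair_finite_verts)

lemma nbrs_subset: "nbrs i \<subseteq> V"
  using arc_snd_in_verts by force

lemma finite_nbrs: "finite (nbrs i)"
  using nbrs_subset finite_V by (rule finite_subset)

lemma V_nonempty: "V \<noteq> {}"
  using connected by (simp add: Digraph_Component.connected_def strongly_connected_def)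

lemma wdegree_nonneg: "i \<in> V \<Longrightarrow> wdegree i \<ge> 0"
  unfolding wdegree_def
  by (intro divide_nonneg_pos sum_nonneg measure_pos) (simp_all add: weight_pos less_imp_le)

text \<open>Connectedness as an induction principle: the arcs are symmetric, so \<open>l\<close> is
  reachable from \<open>i\<close> along directed arcs.\<close>

lemma arc_propagation:
  assumes "i \<in> V" and "P i" and "\<And>j k. (j, k) \<in> parcs G \<Longrightarrow> P j \<Longrightarrow> P k" and "l \<in> V"
  shows "P l"
proof -
  have "strongly_connected (with_proj G)"
    using connected sym_arcs by (intro symmetric_connected_imp_strongly_connected) auto
  then have "i \<rightarrow>\<^sup>*\<^bsub>with_proj G\<^esub> l"
    using assms(1,4) by (auto simp: strongly_connected_def)
  then show "P l"
    using assms(2,3) by (induction rule: reachable_induct) auto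
qed

lemma ex_vertex_min:
  obtains i where "i \<in> V" and "\<And>j. j \<in> V \<Longrightarrow> (f i :: real) \<le> f j"
proof
  show "arg_min_on f V \<in> V"
    using finite_V V_nonempty by (rule arg_min_if_finite)
  show "f (arg_min_on f V) \<le> f j" if "j \<in> V" for j
    using finite_V V_nonempty that by (rule arg_min_least)
qed

lemma ex_bound: "\<exists>H>0. \<forall>i\<in>V. \<bar>f i :: real\<bar> \<le> H"
proof (intro exI conjI ballI)
  \<comment> \<open>The summand 1 keeps the bound positive even for \<open>f = 0\<close>; later
    proofs divide by it.\<close>
  show "0 < 1 + (\<Sum>i\<in>V. \<bar>f i\<bar>)"
    by (simp add: add_pos_nonneg sum_nonneg)
  fix i assume "i \<in> V"
  then show "\<bar>f i\<bar> \<le> 1 + (\<Sum>i\<in>V. \<bar>f i\<bar>)"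
    using member_le_sum[of i V "\<lambda>i. \<bar>f i\<bar>"] finite_V by auto
qed

lemma laplacian_expand:
  assumes "i \<in> V"
  shows "\<Delta> f i = (\<Sum>j\<in>nbrs i. \<omega> i j * (f j - m)) / \<mu> i - wdegree i * (f i - m)"
proof -
  have "(\<Sum>j\<in>nbrs i. \<omega> i j * (f j - f i))
      = (\<Sum>j\<in>nbrs i. \<omega> i j * (f j - m)) - (\<Sum>j\<in>nbrs i. \<omega> i j) * (f i - m)"
    unfolding sum_distrib_right sum_subtractf[symmetric]
    by (intro sum.cong) (auto simp: algebra_simps)
  then show ?thesis
    by (simp add: laplacian_def wdegree_def diff_divide_distrib)
qed

text \<open>The differences enter with positive weights. This is the comparison principle at a point
  where two functions touch.\<close>

lemma laplacian_mono:
  assumes "i \<in> V" and "f i = g i" and "\<And>j. j \<in> V \<Longrightarrow> f j \<le> g j"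
  shows "\<Delta> f i \<le> \<Delta> g i"
  unfolding laplacian_def
proof (intro mult_left_mono sum_mono)
  fix j assume "j \<in> nbrs i"
  then show "f j - f i \<le> g j - g i" "0 \<le> \<omega> i j"
    using assms(2) assms(3)[of j] weight_pos[of i j] nbrs_subset[of i] by auto
qed (use measure_pos[OF assms(1)] in simp)

lemma laplacian_tendsto:
  assumes "\<And>j. j \<in> V \<Longrightarrow> ((\<lambda>x. f x j) \<longlongrightarrow> g j) F" and "i \<in> V"
  shows "((\<lambda>x. \<Delta> (f x) i) \<longlongrightarrow> \<Delta> g i) F"
  unfolding laplacian_def
proof (intro tendsto_mult tendsto_const tendsto_sum tendsto_diff assms)
  fix j assume "j \<in> nbrs i"
  then show "j \<in> V" using nbrs_subset by blast
qed

lemma laplacian_const: "\<Delta> (\<lambda>_. a) i = 0"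
  by (simp add: laplacian_def)

lemma laplacian_affine: "\<Delta> (\<lambda>i. a * f i + b) i = a * \<Delta> f i"
proof -
  have "(\<Sum>j\<in>nbrs i. \<omega> i j * ((a * f j + b) - (a * f i + b)))
      = a * (\<Sum>j\<in>nbrs i. \<omega> i j * (f j - f i))"
    unfolding sum_distrib_left by (intro sum.cong) (auto simp: algebra_simps)
  then show ?thesis by (simp add: laplacian_def)
qed

lemma laplacian_lower_bound:
  assumes "i \<in> V" and "\<And>j. j \<in> V \<Longrightarrow> m \<le> f j"
  shows "\<Delta> f i \<ge> - wdegree i * (f i - m)"
proof -
  have "(\<Sum>j\<in>nbrs i. \<omega> i j * (f j - m)) / \<mu> i \<ge> 0"
    using assms measure_pos[of i] weight_pos nbrs_subset[of i]
    by (intro divide_nonneg_pos sum_nonneg mult_nonneg_nonneg) (auto simp: subset_iff less_imp_le)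
  then show ?thesis
    unfolding laplacian_expand[OF assms(1), of f m] by simp
qed

text \<open>The flow \<open>\<omega> i j * (f j - f i)\<close> along an arc changes sign when the
  arc is reversed. Extended by zero to all pairs of vertices, its double sum therefore equals its
  own negative.\<close>

lemma sum_laplacian: "(\<Sum>i\<in>V. \<mu> i * \<Delta> f i) = 0"
proof -
  let ?T = "\<lambda>i j. if (i, j) \<in> parcs G then \<omega> i j * (f j - f i) else 0"
  have sum_T: "\<mu> i * \<Delta> f i = (\<Sum>j\<in>V. ?T i j)" if "i \<in> V" for i
  proof -
    have "V \<inter> nbrs i = nbrs i" using nbrs_subset[of i] by auto
    then have "(\<Sum>j\<in>V. ?T i j) = (\<Sum>j\<in>nbrs i. \<omega> i j * (f j - f i))"
      using finite_V sum.inter_restrict[of V "\<lambda>j. \<omega> i j * (f j - f i)" "nbrs i"] by simp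
    then show ?thesis
      using measure_pos[OF that] by (simp add: laplacian_def)
  qed
  have antisym: "?T i j = - ?T j i" for i j
  proof -
    have "(i, j) \<in> parcs G \<longleftrightarrow> (j, i) \<in> parcs G"
      using sym_arcs by (auto simp: symmetric_def sym_def)
    then show ?thesis
      using weight_sym[of i j] by (auto simp: algebra_simps)
  qed
  have "(\<Sum>i\<in>V. \<Sum>j\<in>V. ?T i j) = (\<Sum>i\<in>V. \<Sum>j\<in>V. ?T j i)"
    by (rule sum.swap)
  also have "\<dots> = - (\<Sum>i\<in>V. \<Sum>j\<in>V. ?T i j)"
    unfolding sum_negf[symmetric] by (intro sum.cong refl antisym)
  finally show ?thesis using sum_T by simp
qed

text \<open>Strong minimum principle: at a minimum the terms of the Laplacian are nonnegative and
  sum to zero, so each vanishes and the minimum spreads along the arcs.\<close>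

lemma harmonic_imp_constant:
  assumes "\<And>i. i \<in> V \<Longrightarrow> \<Delta> f i = 0" and "i \<in> V" and "j \<in> V"
  shows "f i = f j"
proof -
  obtain k where k: "k \<in> V" "\<And>j. j \<in> V \<Longrightarrow> f k \<le> f j"
    using ex_vertex_min[of f] by blast
  have "f l = f k" if "l \<in> V" for l
  proof (rule arc_propagation[where P = "\<lambda>l. f l = f k", OF k(1) refl _ that])
    fix p q assume pq: "(p, q) \<in> parcs G" "f p = f k"
    have p: "p \<in> V" using pq(1) arc_fst_in_verts by force
    have "(\<Sum>j\<in>nbrs p. \<omega> p j * (f j - f p)) = 0"
      using assms(1)[OF p] measure_pos[OF p] by (simp add: laplacian_def)
    moreover have "\<omega> p j * (f j - f p) \<ge> 0" if "j \<in> nbrs p" for j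
      using that k(2)[of j] pq(2) weight_pos[of p j] nbrs_subset[of p] by auto
    ultimately have "\<omega> p q * (f q - f p) = 0"
      using pq(1) finite_nbrs[of p]
        sum_nonneg_eq_0_iff[of "nbrs p" "\<lambda>j. \<omega> p j * (f j - f p)"] by simp
    then show "f q = f k"
      using weight_pos[OF pq(1)] pq(2) by simp
  qed
  then show ?thesis using assms by metis
qed

section \<open>Sub- and supersolutions\<close>

text \<open>
  Perron's method: a subsolution of maximal total mass below the supersolution is a solution, since
  raising it at a single vertex only increases its Laplacian at all other vertices.
\<close>

lemma sub_supersolution:
  fixes g :: "'a \<Rightarrow> real \<Rightarrow> real"
  assumes cont: "\<And>i t. i \<in> V \<Longrightarrow> isCont (g i) t"
    and le: "\<And>i. i \<in> V \<Longrightarrow> \<psi> i \<le> \<phi> i"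
    and sub: "\<And>i. i \<in> V \<Longrightarrow> \<Delta> \<psi> i + g i (\<psi> i) \<ge> 0"
    and super: "\<And>i. i \<in> V \<Longrightarrow> \<Delta> \<phi> i + g i (\<phi> i) \<le> 0"
  obtains u where "\<And>i. i \<in> V \<Longrightarrow> \<psi> i \<le> u i \<and> u i \<le> \<phi> i \<and> \<Delta> u i + g i (u i) = 0"
proof -
  define S where "S = {u. \<forall>i\<in>V. \<psi> i \<le> u i \<and> u i \<le> \<phi> i \<and> 0 \<le> \<Delta> u i + g i (u i)}"
  define mass where "mass u = (\<Sum>i\<in>V. u i :: real)" for u
  define s where "s = (SUP u\<in>S. mass u)"
  have "\<psi> \<in> S" using le sub by (auto simp: S_def)
  have bdd: "bdd_above (mass ` S)"
    by (rule bdd_aboveI[of _ "mass \<phi>"]) (auto simp: mass_def S_def intro: sum_mono)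
  \<comment> \<open>A maximising sequence for the mass. The conditions defining \<open>S\<close> are
    closed, so a limit of a subsequence stays in \<open>S\<close> and attains the supremum.\<close>
  have "\<exists>v\<in>S. mass v > s - 1 / real (Suc n)" for n
  proof -
    have "s - 1 / real (Suc n) < s" by simp
    then show ?thesis
      unfolding s_def using less_cSUP_iff[OF _ bdd] \<open>\<psi> \<in> S\<close> by blast
  qed
  then obtain v where v: "\<And>n. v n \<in> S" "\<And>n. mass (v n) > s - 1 / real (Suc n)"
    by metis
  obtain r u where r: "strict_mono r" and lim: "\<And>i. i \<in> V \<Longrightarrow> (\<lambda>n. v (r n) i) \<longlonglongrightarrow> u i"
    using finite_pointwise_bounded_convergent_subseq[OF finite_V, of \<psi> v \<phi>] v(1)
    by (auto simp: S_def)
  have uS: "u \<in> S"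
    unfolding S_def
  proof (intro CollectI ballI conjI)
    fix i assume i: "i \<in> V"
    show "\<psi> i \<le> u i"
      using v(1) i by (intro LIMSEQ_le_const[OF lim[OF i]]) (auto simp: S_def)
    show "u i \<le> \<phi> i"
      using v(1) i by (intro LIMSEQ_le_const2[OF lim[OF i]]) (auto simp: S_def)
    have "(\<lambda>n. \<Delta> (v (r n)) i + g i (v (r n) i)) \<longlonglongrightarrow> \<Delta> u i + g i (u i)"
      by (intro tendsto_add laplacian_tendsto lim i isCont_tendsto_compose[OF cont])
    then show "0 \<le> \<Delta> u i + g i (u i)"
      using v(1) i by (intro LIMSEQ_le_const) (auto simp: S_def)
  qed
  have "(\<lambda>n. s - 1 / real (Suc (r n))) \<longlonglongrightarrow> s - 0"
    using LIMSEQ_subseq_LIMSEQ[OF LIMSEQ_Suc[OF lim_1_over_n] r]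
    by (intro tendsto_diff tendsto_const) (simp add: o_def)
  moreover have "(\<lambda>n. mass (v (r n))) \<longlonglongrightarrow> mass u"
    unfolding mass_def by (intro tendsto_sum lim)
  ultimately have u_max: "s \<le> mass u"
    using LIMSEQ_le[of "\<lambda>n. s - 1 / real (Suc (r n))" s "\<lambda>n. mass (v (r n))" "mass u"]
      less_imp_le[OF v(2)] by auto
  have "\<Delta> u i + g i (u i) = 0" if i: "i \<in> V" for i
  proof (rule ccontr)
    assume "\<Delta> u i + g i (u i) \<noteq> 0"
    then have pos: "\<Delta> u i + g i (u i) > 0"
      using uS i by (auto simp: S_def less_le)
    \<comment> \<open>Touching \<open>\<phi>\<close> at \<open>i\<close> would give
      \<open>\<Delta> u i + g i (u i) \<le> 0\<close> by comparison. Hence there is room to raise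
      \<open>u\<close> at \<open>i\<close>.\<close>
    have "u i \<noteq> \<phi> i"
    proof
      assume eq: "u i = \<phi> i"
      then have "\<Delta> u i \<le> \<Delta> \<phi> i"
        using uS by (intro laplacian_mono i) (auto simp: S_def)
      then show False using pos super[OF i] eq by simp
    qed
    then have lt: "u i < \<phi> i"
      using uS i by (auto simp: S_def less_le)
    \<comment> \<open>For small positive \<open>\<delta>\<close>, continuity preserves the strict
      inequality at \<open>i\<close>, so the raised function lies in \<open>S\<close> with a larger
      mass.\<close>
    let ?u = "\<lambda>\<delta>. u(i := u i + \<delta>)"
    have "((\<lambda>\<delta>. u i + \<delta>) \<longlongrightarrow> u i + 0) (at_right 0)"
      by (intro tendsto_intros)
    then have ui: "((\<lambda>\<delta>. u i + \<delta>) \<longlongrightarrow> u i) (at_right 0)"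
      by simp
    have "((\<lambda>\<delta>. \<Delta> (?u \<delta>) i + g i (u i + \<delta>)) \<longlongrightarrow> \<Delta> u i + g i (u i)) (at_right 0)"
    proof (intro tendsto_add laplacian_tendsto i isCont_tendsto_compose[OF cont] ui)
      show "((\<lambda>\<delta>. ?u \<delta> j) \<longlongrightarrow> u j) (at_right 0)" for j
        using ui by (cases "j = i") auto
    qed
    then have "\<forall>\<^sub>F \<delta> in at_right 0. \<Delta> (?u \<delta>) i + g i (u i + \<delta>) > 0"
      using pos by (rule order_tendstoD)
    moreover have "\<forall>\<^sub>F \<delta> in at_right 0. u i + \<delta> < \<phi> i"
      using ui lt by (rule order_tendstoD)
    moreover have "\<forall>\<^sub>F \<delta> in at_right 0. (0::real) < \<delta>"
      by (rule eventually_at_right_less)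
    ultimately have "\<forall>\<^sub>F \<delta> in at_right 0. \<Delta> (?u \<delta>) i + g i (u i + \<delta>) > 0 \<and> u i + \<delta> < \<phi> i \<and> 0 < \<delta>"
      by eventually_elim auto
    then obtain \<delta> where \<delta>: "\<Delta> (?u \<delta>) i + g i (u i + \<delta>) > 0" "u i + \<delta> < \<phi> i" "0 < \<delta>"
      using eventually_happens'[OF trivial_limit_at_right_real[of "0::real"]] by blast
    have "?u \<delta> \<in> S"
      unfolding S_def
    proof (intro CollectI ballI)
      fix j assume j: "j \<in> V"
      show "\<psi> j \<le> ?u \<delta> j \<and> ?u \<delta> j \<le> \<phi> j \<and> 0 \<le> \<Delta> (?u \<delta>) j + g j (?u \<delta> j)"
      proof (cases "j = i")
        case True
        have "\<psi> i \<le> u i" using uS i by (auto simp: S_def)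
        then show ?thesis using \<delta> True by auto
      next
        case False
        have "\<Delta> u j \<le> \<Delta> (?u \<delta>) j"
          using False \<delta>(3) by (intro laplacian_mono j) auto
        then show ?thesis using False uS j by (force simp: S_def)
      qed
    qed
    then have "mass (?u \<delta>) \<le> s"
      unfolding s_def by (intro cSUP_upper bdd)
    moreover have "mass (?u \<delta>) = mass u + \<delta>"
      unfolding mass_def using i finite_V by (simp add: sum.remove[of V i])
    ultimately show False using u_max \<delta>(3) by simp
  qed
  then show thesis using uS that[of u] by (auto simp: S_def)
qed

text \<open>
  As \<open>\<epsilon>\<close> tends to 0, the solutions of \<open>\<epsilon> v - \<Delta> v = h\<close> are such that \<open>\<epsilon> v\<close> accumulates only at
  harmonic functions with the same average as \<open>h\<close>, so \<open>\<Delta> v + h = \<epsilon> v\<close> is negative for some \<open>\<epsilon>\<close>.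
\<close>

lemma ex_laplacian_add_neg:
  assumes "(\<Sum>i\<in>V. \<mu> i * h i) < 0"
  obtains v where "\<And>i. i \<in> V \<Longrightarrow> \<Delta> v i + h i < 0"
proof -
  obtain H where H: "H > 0" "\<And>i. i \<in> V \<Longrightarrow> \<bar>h i\<bar> \<le> H"
    using ex_bound[of h] by auto
  define e where "e n = inverse (real (Suc n))" for n
  have e_pos: "e n > 0" for n by (simp add: e_def)
  have "\<exists>v. \<forall>i\<in>V. - H \<le> e n * v i \<and> e n * v i \<le> H \<and> \<Delta> v i + h i = e n * v i" for n
  proof -
    \<comment> \<open>Since \<open>\<bar>h i\<bar> \<le> H\<close>, two opposite constants serve as
      sub- and supersolution. They confine \<open>e n * v\<close> to an interval independent of
      \<open>n\<close>.\<close>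
    obtain v where v: "\<And>i. i \<in> V \<Longrightarrow> - H / e n \<le> v i \<and> v i \<le> H / e n \<and> \<Delta> v i + (h i - e n * v i) = 0"
    proof (rule sub_supersolution[of "\<lambda>i t. h i - e n * t" "\<lambda>_. - H / e n" "\<lambda>_. H / e n"])
      fix i assume "i \<in> V"
      then have "\<bar>h i\<bar> \<le> H" by (rule H)
      then show "0 \<le> \<Delta> (\<lambda>_. - H / e n) i + (h i - e n * (- H / e n))"
        and "\<Delta> (\<lambda>_. H / e n) i + (h i - e n * (H / e n)) \<le> 0"
        using e_pos[of n] by (auto simp: laplacian_const)
      show "- H / e n \<le> H / e n" using H(1) e_pos[of n] by (simp add: divide_right_mono)
    qed (auto intro!: continuous_intros)
    show ?thesis
    proof (intro exI ballI)
      fix i assume "i \<in> V"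
      from v[OF this] e_pos[of n]
      show "- H \<le> e n * v i \<and> e n * v i \<le> H \<and> \<Delta> v i + h i = e n * v i"
        by (auto simp: field_simps)
    qed
  qed
  then obtain v where v: "\<And>n i. i \<in> V \<Longrightarrow> - H \<le> e n * v n i \<and> e n * v n i \<le> H \<and> \<Delta> (v n) i + h i = e n * v n i"
    by metis
  obtain r w where r: "strict_mono r" and lim: "\<And>i. i \<in> V \<Longrightarrow> (\<lambda>n. e (r n) * v (r n) i) \<longlonglongrightarrow> w i"
    using finite_pointwise_bounded_convergent_subseq[OF finite_V, of "\<lambda>_. - H" "\<lambda>n i. e n * v n i" "\<lambda>_. H"] v
    by blast
  have e_lim: "(\<lambda>n. e (r n)) \<longlonglongrightarrow> 0"
    using LIMSEQ_subseq_LIMSEQ[OF LIMSEQ_inverse_real_of_nat r] by (simp add: o_def e_def)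
  have harmonic: "\<Delta> w i = 0" if i: "i \<in> V" for i
  proof -
    \<comment> \<open>The equation multiplied by \<open>e n\<close> has as its right-hand side
      \<open>e n\<close> times a bounded quantity, which vanishes in the limit.\<close>
    have "\<Delta> (\<lambda>j. e n * v n j) i = e n * (e n * v n i - h i)" for n
    proof -
      have "\<Delta> (v n) i = e n * v n i - h i" using v[OF i, of n] by simp
      then show ?thesis using laplacian_affine[of "e n" "v n" 0 i] by simp
    qed
    moreover have "(\<lambda>n. e (r n) * (e (r n) * v (r n) i - h i)) \<longlonglongrightarrow> 0 * (w i - h i)"
      by (intro tendsto_intros e_lim lim i)
    ultimately have "(\<lambda>n. \<Delta> (\<lambda>j. e (r n) * v (r n) j) i) \<longlonglongrightarrow> 0"
      by simp
    moreover have "(\<lambda>n. \<Delta> (\<lambda>j. e (r n) * v (r n) j) i) \<longlonglongrightarrow> \<Delta> w i"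
      by (intro laplacian_tendsto lim i)
    ultimately show ?thesis using LIMSEQ_unique by blast
  qed
  \<comment> \<open>The Laplacian has weighted sum zero, so the weighted sum of \<open>h\<close>
    passes to \<open>e n * v n\<close> and then to its limit \<open>w\<close>.\<close>
  have "(\<Sum>i\<in>V. \<mu> i * (e n * v n i)) = (\<Sum>i\<in>V. \<mu> i * h i)" for n
  proof -
    have "(\<Sum>i\<in>V. \<mu> i * (e n * v n i)) = (\<Sum>i\<in>V. \<mu> i * \<Delta> (v n) i + \<mu> i * h i)"
      using v by (intro sum.cong) (auto simp flip: distrib_left)
    then show ?thesis by (simp add: sum.distrib sum_laplacian)
  qed
  moreover have "(\<lambda>n. \<Sum>i\<in>V. \<mu> i * (e (r n) * v (r n) i)) \<longlonglongrightarrow> (\<Sum>i\<in>V. \<mu> i * w i)"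
    by (intro tendsto_intros lim)
  ultimately have sum_w: "(\<Sum>i\<in>V. \<mu> i * w i) = (\<Sum>i\<in>V. \<mu> i * h i)"
    by (simp add: LIMSEQ_const_iff)
  have "w i < 0" if i: "i \<in> V" for i
  proof (rule ccontr)
    assume "\<not> w i < 0"
    then have "w j \<ge> 0" if "j \<in> V" for j
      using harmonic_imp_constant[OF harmonic i that] by simp
    then have "(\<Sum>i\<in>V. \<mu> i * w i) \<ge> 0"
      using measure_pos by (intro sum_nonneg mult_nonneg_nonneg) (auto intro: less_imp_le)
    then show False using sum_w assms by simp
  qed
  then have "\<forall>i\<in>V. \<forall>\<^sub>F n in sequentially. e (r n) * v (r n) i < 0"
    using order_tendstoD(2)[OF lim] by blast
  then have "\<forall>\<^sub>F n in sequentially. \<forall>i\<in>V. e (r n) * v (r n) i < 0"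
    by (simp add: eventually_ball_finite_distrib finite_V)
  then obtain n where "\<forall>i\<in>V. e (r n) * v (r n) i < 0"
    using eventually_happens'[OF sequentially_bot] by blast
  then show thesis
    using v that[of "v (r n)"] by simp
qed

section \<open>Solvability for negative \<open>c\<close>\<close>

lemma kw_solvable_if_supersolution:
  assumes "c < 0" and super: "\<And>i. i \<in> V \<Longrightarrow> \<Delta> \<phi> i \<le> c - h i * exp (\<phi> i)"
  shows "\<exists>u. kazdan_warner_solution G \<mu> \<omega> h c u"
proof -
  obtain H where H: "H > 0" "\<And>i. i \<in> V \<Longrightarrow> \<bar>h i\<bar> \<le> H"
    using ex_bound[of h] by auto
  obtain k where k: "k \<in> V" "\<And>j. j \<in> V \<Longrightarrow> \<phi> k \<le> \<phi> j"
    using ex_vertex_min[of \<phi>] by blast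
  \<comment> \<open>The first bound places the constant \<open>a\<close> below
    \<open>\<phi>\<close>; the second gives \<open>H * exp a \<le> - c\<close>, which makes it a
    subsolution.\<close>
  define a where "a = min (\<phi> k) (ln (- c / H))"
  have "exp a \<le> - c / H"
    using exp_ln[of "- c / H"] H(1) assms(1) unfolding a_def
    by (metis divide_pos_pos exp_le_cancel_iff min.cobounded2 neg_0_less_iff_less)
  then have a: "H * exp a \<le> - c"
    using H(1) by (simp add: field_simps)
  obtain u where u: "\<And>i. i \<in> V \<Longrightarrow> a \<le> u i \<and> u i \<le> \<phi> i \<and> \<Delta> u i + (h i * exp (u i) - c) = 0"
  proof (rule sub_supersolution[of "\<lambda>i t. h i * exp t - c" "\<lambda>_. a" \<phi>])
    fix i assume i: "i \<in> V"
    show "a \<le> \<phi> i" using k(2)[OF i] by (simp add: a_def)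
    have "- h i * exp a \<le> H * exp a"
      using H(2)[OF i] by (intro mult_right_mono) auto
    then show "0 \<le> \<Delta> (\<lambda>_. a) i + (h i * exp a - c)"
      using a by (simp add: laplacian_const)
    show "\<Delta> \<phi> i + (h i * exp (\<phi> i) - c) \<le> 0"
      using super[OF i] by simp
  qed (auto intro!: continuous_intros)
  have "kazdan_warner_solution G \<mu> \<omega> h c u"
    unfolding kazdan_warner_solution_def using u by force
  then show ?thesis by blast
qed

text \<open>A solution for \<open>c\<close> is a supersolution for every larger constant.\<close>

lemma kw_solvable_upward:
  assumes "kazdan_warner_solution G \<mu> \<omega> h c u" and "c \<le> c'" and "c' < 0"
  shows "\<exists>u. kazdan_warner_solution G \<mu> \<omega> h c' u"
proof (rule kw_solvable_if_supersolution[OF assms(3)])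
  show "\<Delta> u i \<le> c' - h i * exp (u i)" if "i \<in> V" for i
    using assms(1,2) that by (simp add: kazdan_warner_solution_def)
qed

lemma kw_solvable_near_zero:
  assumes "(\<Sum>i\<in>V. \<mu> i * h i) < 0"
  shows "\<exists>c<0. \<exists>u. kazdan_warner_solution G \<mu> \<omega> h c u"
proof -
  obtain v where v: "\<And>i. i \<in> V \<Longrightarrow> \<Delta> v i + h i < 0"
    using ex_laplacian_add_neg[OF assms] by blast
  \<comment> \<open>For \<open>a * v + ln a\<close> the supersolution condition reads
    \<open>a * (\<Delta> v i + h i * exp (a * v i)) \<le> c\<close>. The second factor tends to
    \<open>\<Delta> v i + h i\<close> as \<open>a\<close> tends to 0.\<close>
  have "\<forall>\<^sub>F a in at_right 0. \<Delta> v i + h i * exp (a * v i) < 0" if i: "i \<in> V" for i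
  proof -
    have "((\<lambda>a. \<Delta> v i + h i * exp (a * v i)) \<longlongrightarrow> \<Delta> v i + h i * exp (0 * v i)) (at_right 0)"
      by (intro tendsto_intros)
    then show ?thesis using v[OF i] by (intro order_tendstoD) auto
  qed
  then have "\<forall>\<^sub>F a in at_right 0. \<forall>i\<in>V. \<Delta> v i + h i * exp (a * v i) < 0"
    by (simp add: eventually_ball_finite_distrib finite_V)
  then have "\<forall>\<^sub>F a in at_right 0. (\<forall>i\<in>V. \<Delta> v i + h i * exp (a * v i) < 0) \<and> 0 < a"
    using eventually_at_right_less[of "0::real"] by (rule eventually_conj)
  then obtain a where a: "\<And>i. i \<in> V \<Longrightarrow> \<Delta> v i + h i * exp (a * v i) < 0" "0 < a"
    using eventually_happens'[OF trivial_limit_at_right_real[of "0::real"]] by blast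
  \<comment> \<open>At \<open>k\<close> the negative factor is largest, so its value there yields a
    \<open>c\<close> that works at all vertices.\<close>
  obtain k where k: "k \<in> V" "\<And>j. j \<in> V \<Longrightarrow> - (\<Delta> v k + h k * exp (a * v k)) \<le> - (\<Delta> v j + h j * exp (a * v j))"
    using ex_vertex_min[of "\<lambda>j. - (\<Delta> v j + h j * exp (a * v j))"] by auto
  define c where "c = a * (\<Delta> v k + h k * exp (a * v k))"
  have "c < 0" using a k(1) by (simp add: c_def mult_pos_neg)
  moreover have "\<exists>u. kazdan_warner_solution G \<mu> \<omega> h c u"
  proof (rule kw_solvable_if_supersolution[OF \<open>c < 0\<close>, of "\<lambda>i. a * v i + ln a"])
    fix i assume i: "i \<in> V"
    have "a * (\<Delta> v i + h i * exp (a * v i)) \<le> c"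
      unfolding c_def using k(2)[OF i] a(2) by (intro mult_left_mono) auto
    then show "\<Delta> (\<lambda>i. a * v i + ln a) i \<le> c - h i * exp (a * v i + ln a)"
      using a(2) unfolding laplacian_affine by (simp add: exp_add algebra_simps)
  qed
  ultimately show ?thesis by blast
qed

lemma kw_solvable_if_nonpos:
  assumes "(\<Sum>i\<in>V. \<mu> i * h i) < 0" and "\<And>i. i \<in> V \<Longrightarrow> h i \<le> 0" and "c < 0"
  shows "\<exists>u. kazdan_warner_solution G \<mu> \<omega> h c u"
proof -
  obtain v where v: "\<And>i. i \<in> V \<Longrightarrow> \<Delta> v i + h i < 0"
    using ex_laplacian_add_neg[OF assms(1)] by blast
  obtain k where k: "k \<in> V" "\<And>j. j \<in> V \<Longrightarrow> - (\<Delta> v k + h k) \<le> - (\<Delta> v j + h j)"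
    using ex_vertex_min[of "\<lambda>j. - (\<Delta> v j + h j)"] by auto
  \<comment> \<open>As \<open>\<Delta> v + h\<close> is largest at \<open>k\<close>, this gives
    \<open>a * (\<Delta> v i + h i) \<le> c\<close> everywhere, with equality at
    \<open>k\<close>.\<close>
  define a where "a = c / (\<Delta> v k + h k)"
  have a: "a > 0" "a * (\<Delta> v k + h k) = c"
    using v[OF k(1)] assms(3) by (auto simp: a_def divide_neg_neg)
  obtain l where l: "l \<in> V" "\<And>j. j \<in> V \<Longrightarrow> a * v l \<le> a * v j"
    using ex_vertex_min[of "\<lambda>j. a * v j"] by auto
  \<comment> \<open>This lifts \<open>a * v i + b\<close> to at least \<open>ln a\<close>; then
    \<open>h i \<le> 0\<close> gives \<open>h i * exp (a * v i + b) \<le> h i * a\<close>.\<close>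
  define b where "b = ln a - a * v l"
  show ?thesis
  proof (rule kw_solvable_if_supersolution[OF assms(3), of "\<lambda>i. a * v i + b"])
    fix i assume i: "i \<in> V"
    have "a * (\<Delta> v i + h i) \<le> a * (\<Delta> v k + h k)"
      using k(2)[OF i] a(1) by (intro mult_left_mono) auto
    moreover have "exp (ln a) \<le> exp (a * v i + b)"
      using l(2)[OF i] by (simp add: b_def)
    then have "h i * exp (a * v i + b) \<le> h i * a"
      using assms(2)[OF i] a(1) by (intro mult_left_mono_neg) auto
    ultimately show "\<Delta> (\<lambda>i. a * v i + b) i \<le> c - h i * exp (a * v i + b)"
      unfolding laplacian_affine a(2)[symmetric] by (simp add: algebra_simps)
  qed
qed

section \<open>A priori estimates and the critical constant\<close>

lemma kw_solution_lower_bound: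
  assumes sol: "kazdan_warner_solution G \<mu> \<omega> h c u" and "c < 0"
    and H: "H > 0" "\<And>i. i \<in> V \<Longrightarrow> \<bar>h i\<bar> \<le> H" and i: "i \<in> V"
  shows "ln (- c / H) \<le> u i"
proof -
  obtain k where k: "k \<in> V" "\<And>j. j \<in> V \<Longrightarrow> u k \<le> u j"
    using ex_vertex_min[of u] by blast
  have "0 \<le> \<Delta> u k"
    using laplacian_lower_bound[OF k(1), of "u k" u] k(2) by simp
  then have "- c \<le> - h k * exp (u k)"
    using sol k(1) by (simp add: kazdan_warner_solution_def)
  also have "\<dots> \<le> H * exp (u k)"
    using H(2)[OF k(1)] by (intro mult_right_mono) auto
  finally have "- c / H \<le> exp (u k)"
    using H(1) by (simp add: field_simps)
  then have "ln (- c / H) \<le> u k"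
    using H(1) assms(2) divide_pos_pos[of "- c" H] ln_mono[of "- c / H" "exp (u k)"] by simp
  then show ?thesis using k(2)[OF i] by simp
qed

lemma kw_solution_exp_bound:
  assumes sol: "kazdan_warner_solution G \<mu> \<omega> h c u" and "i \<in> V" and "\<And>j. j \<in> V \<Longrightarrow> m \<le> u j"
  shows "h i * exp (u i) \<le> c + wdegree i * (u i - m)"
proof -
  have "\<Delta> u i \<ge> - wdegree i * (u i - m)"
    using assms(2,3) by (rule laplacian_lower_bound)
  moreover have "\<Delta> u i = c - h i * exp (u i)"
    using assms(1,2) by (simp add: kazdan_warner_solution_def)
  ultimately show ?thesis by simp
qed

text \<open>The infimum of the solvable negative constants qualifies, taken in \<open>ereal\<close>
  to admit \<open>-\<infinity>\<close>. Solvability near zero makes it negative, and upward closure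
  gives solvability above it.\<close>

lemma ex_critical_constant:
  assumes "(\<Sum>i\<in>V. \<mu> i * h i) < 0"
  shows "\<exists>C. is_critical_constant G \<mu> \<omega> h C"
proof
  define S where "S = {c. c < 0 \<and> (\<exists>u. kazdan_warner_solution G \<mu> \<omega> h c u)}"
  let ?C = "INF c\<in>S. ereal c"
  show "is_critical_constant G \<mu> \<omega> h ?C"
    unfolding is_critical_constant_def
  proof (intro conjI allI impI)
    obtain c where "c \<in> S" using kw_solvable_near_zero[OF assms] by (auto simp: S_def)
    then have "?C \<le> ereal c" "ereal c < 0" by (auto intro: INF_lower simp: S_def)
    then show neg: "?C < 0" by (rule le_less_trans)
    fix c assume "ereal c < ?C"
    moreover from this have "ereal c < 0" using neg by (rule less_trans)
    moreover have "?C \<le> ereal c" if "c \<in> S" using that by (rule INF_lower)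
    ultimately have "c \<notin> S" "c < 0" by (auto simp: not_less[symmetric])
    then show "\<nexists>u. kazdan_warner_solution G \<mu> \<omega> h c u"
      by (auto simp: S_def)
  next
    fix c assume c: "?C < ereal c \<and> c < 0"
    then obtain d where "d \<in> S" "d < c" by (auto simp: INF_less_iff)
    then show "\<exists>u. kazdan_warner_solution G \<mu> \<omega> h c u"
      using c kw_solvable_upward[of h d _ c] by (auto simp: S_def)
  qed
qed

lemma nonpos_if_kw_solvable:
  assumes "\<And>c. c < 0 \<Longrightarrow> \<exists>u. kazdan_warner_solution G \<mu> \<omega> h c u" and i: "i \<in> V"
  shows "h i \<le> 0"
proof (rule ccontr)
  assume "\<not> h i \<le> 0"
  then have "h i > 0" by simp
  then obtain k where k: "\<And>t. h i * exp t \<ge> wdegree i * t + t - k"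
    using exp_dominates_linear wdegree_nonneg[OF i] by blast
  obtain H where H: "H > 0" "\<And>i. i \<in> V \<Longrightarrow> \<bar>h i\<bar> \<le> H"
    using ex_bound[of h] by auto
  \<comment> \<open>\<open>H \<le> - c\<close> makes all solutions nonnegative, while the
    exponential bound forces \<open>u i \<le> c + k < 0\<close>.\<close>
  define c where "c = - max H (\<bar>k\<bar> + 1)"
  have c: "c < 0" "H \<le> - c" "c + k < 0" by (auto simp: c_def)
  obtain u where u: "kazdan_warner_solution G \<mu> \<omega> h c u"
    using assms(1)[OF c(1)] by auto
  have "ln (- c / H) \<ge> 0" using c(2) H(1) by (intro ln_ge_zero) (simp add: field_simps)
  then have ge: "0 \<le> u j" if "j \<in> V" for j
    using kw_solution_lower_bound[OF u c(1) H that] by simp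
  have "u i \<le> c + k"
    using kw_solution_exp_bound[OF u i ge] k[of "u i"] by simp
  then show False using ge[OF i] c(3) by simp
qed

text \<open>
  An upper bound at a vertex bounds the Laplacian there and hence, all values being bounded below,
  also the values at its neighbours.
\<close>

lemma kw_solutions_bounded_above:
  assumes sol: "\<And>n. kazdan_warner_solution G \<mu> \<omega> h (c n) (u n)" and neg: "\<And>n. c n \<le> 0"
    and ge: "\<And>n i. i \<in> V \<Longrightarrow> m \<le> u n i"
    and i: "i \<in> V" "h i > 0" and l: "l \<in> V"
  shows "\<exists>B. \<forall>n. u n l \<le> B"
proof (rule arc_propagation[where P = "\<lambda>l. \<exists>B. \<forall>n. u n l \<le> B", OF i(1) _ _ l])
  obtain k where k: "\<And>t. h i * exp t \<ge> wdegree i * t + t - k"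
    using exp_dominates_linear i(2) wdegree_nonneg[OF i(1)] by blast
  have "u n i \<le> k - wdegree i * m" for n
    using kw_solution_exp_bound[OF sol i(1) ge, of n] k[of "u n i"] neg[of n]
    by (simp add: algebra_simps)
  then show "\<exists>B. \<forall>n. u n i \<le> B" by blast
next
  fix p q assume pq: "(p, q) \<in> parcs G" and "\<exists>B. \<forall>n. u n p \<le> B"
  then obtain B where B: "\<And>n. u n p \<le> B" by blast
  have p: "p \<in> V" and q: "q \<in> V" using pq arc_fst_in_verts arc_snd_in_verts by force+
  \<comment> \<open>The equation at \<open>p\<close> bounds the weighted sum of all
    \<open>u n j - m\<close> over the neighbours by \<open>K\<close>. Its terms are nonnegative, so
    the one for \<open>q\<close> obeys the same bound.\<close>
  define K where "K = \<mu> p * (\<bar>h p\<bar> * exp B + wdegree p * (B - m))"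
  have "u n q \<le> m + K / \<omega> p q" for n
  proof -
    have "- h p * exp (u n p) \<le> \<bar>h p\<bar> * exp B"
      using B[of n] by (intro mult_mono) auto
    then have "\<Delta> (u n) p \<le> \<bar>h p\<bar> * exp B"
      using sol[of n] neg[of n] p by (auto simp: kazdan_warner_solution_def)
    moreover have "wdegree p * (u n p - m) \<le> wdegree p * (B - m)"
      using B[of n] wdegree_nonneg[OF p] by (intro mult_left_mono) auto
    ultimately have "(\<Sum>j\<in>nbrs p. \<omega> p j * (u n j - m)) / \<mu> p \<le> \<bar>h p\<bar> * exp B + wdegree p * (B - m)"
      using laplacian_expand[OF p, of "u n" m] by simp
    then have "(\<Sum>j\<in>nbrs p. \<omega> p j * (u n j - m)) \<le> K"
      using measure_pos[OF p] by (simp add: K_def field_simps)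
    moreover have "\<omega> p q * (u n q - m) \<le> (\<Sum>j\<in>nbrs p. \<omega> p j * (u n j - m))"
      using pq finite_nbrs ge weight_pos nbrs_subset[of p]
      by (intro member_le_sum[of q]) (auto simp: subset_iff less_imp_le)
    ultimately have "\<omega> p q * (u n q - m) \<le> K" by simp
    then show ?thesis
      using weight_pos[OF pq] by (simp add: field_simps)
  qed
  then show "\<exists>B. \<forall>n. u n q \<le> B" by blast
qed

lemma kw_solvable_at_critical:
  assumes crit: "is_critical_constant G \<mu> \<omega> h (ereal C)" and i: "i \<in> V" "h i > 0"
  shows "\<exists>u. kazdan_warner_solution G \<mu> \<omega> h C u"
proof -
  have C: "C < 0" using crit by (simp add: is_critical_constant_def)
  \<comment> \<open>These constants approach \<open>C\<close> from above, starting at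
    \<open>C / 2\<close>. Staying at most \<open>C / 2\<close>, they admit a common lower bound
    \<open>m\<close> for their solutions.\<close>
  define c where "c n = C - C / 2 * inverse (real (Suc n))" for n
  have c: "C < c n" "c n \<le> C / 2" for n
  proof -
    have "0 < inverse (real (Suc n))" "inverse (real (Suc n)) \<le> 1"
      by (auto simp: inverse_eq_divide)
    then have "C / 2 * inverse (real (Suc n)) < 0" "C / 2 * 1 \<le> C / 2 * inverse (real (Suc n))"
      using C by (auto intro!: mult_neg_pos mult_left_mono_neg)
    then show "C < c n" "c n \<le> C / 2" by (auto simp: c_def)
  qed
  have neg: "c n < 0" for n using c(2)[of n] C by simp
  have c_lim: "c \<longlonglongrightarrow> C"
  proof -
    have "c \<longlonglongrightarrow> C - C / 2 * 0"
      unfolding c_def by (intro tendsto_intros LIMSEQ_inverse_real_of_nat)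
    then show ?thesis by simp
  qed
  have "\<exists>u. kazdan_warner_solution G \<mu> \<omega> h (c n) u" for n
    using crit c(1)[of n] neg[of n] by (simp add: is_critical_constant_def)
  then obtain u where u: "\<And>n. kazdan_warner_solution G \<mu> \<omega> h (c n) (u n)"
    by metis
  obtain H where H: "H > 0" "\<And>i. i \<in> V \<Longrightarrow> \<bar>h i\<bar> \<le> H"
    using ex_bound[of h] by auto
  define m where "m = ln (- (C / 2) / H)"
  have ge: "m \<le> u n j" if "j \<in> V" for n j
  proof -
    have "m \<le> ln (- c n / H)"
      unfolding m_def using c(2)[of n] C H(1)
      by (intro ln_mono divide_right_mono) (auto intro: divide_neg_pos)
    then show ?thesis using kw_solution_lower_bound[OF u neg H that, of n] by simp
  qed
  have "\<forall>j\<in>V. \<exists>B. \<forall>n. u n j \<le> B"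
    using kw_solutions_bounded_above[of h c u m i] u less_imp_le[OF neg] ge i by blast
  then obtain B where B: "\<And>n j. j \<in> V \<Longrightarrow> u n j \<le> B j"
    by metis
  obtain r w where r: "strict_mono r" and lim: "\<And>j. j \<in> V \<Longrightarrow> (\<lambda>n. u (r n) j) \<longlonglongrightarrow> w j"
    using finite_pointwise_bounded_convergent_subseq[OF finite_V, of "\<lambda>_. m" u B] ge B by blast
  have "\<Delta> w j = C - h j * exp (w j)" if j: "j \<in> V" for j
  proof -
    have "(\<lambda>n. c (r n) - h j * exp (u (r n) j)) \<longlonglongrightarrow> C - h j * exp (w j)"
      using LIMSEQ_subseq_LIMSEQ[OF c_lim r] by (intro tendsto_intros lim j) (simp add: o_def)
    moreover have "(\<lambda>n. \<Delta> (u (r n)) j) \<longlonglongrightarrow> \<Delta> w j"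
      by (intro laplacian_tendsto lim j)
    ultimately show ?thesis
      using u j LIMSEQ_unique by (simp add: kazdan_warner_solution_def)
  qed
  then show ?thesis by (auto simp: kazdan_warner_solution_def)
qed

end

theorem theorem1p1:
  fixes G :: "'a pair_pre_digraph"
    and \<mu> :: "'a \<Rightarrow> real"
    and \<omega> :: "'a \<Rightarrow> 'a \<Rightarrow> real"
    and h :: "'a \<Rightarrow> real"
  assumes "pair_pseudo_graph G"
    and "Digraph_Component.connected (with_proj G)"
    and "\<And>i. i \<in> pverts G \<Longrightarrow> \<mu> i > 0"
    and "\<And>i j. (i, j) \<in> parcs G \<Longrightarrow> \<omega> i j > 0"
    and "\<And>i j. (i, j) \<in> parcs G \<Longrightarrow> \<omega> i j = \<omega> j i"
    and "graph_average G \<mu> h < 0"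
  shows "(c_minus G \<mu> \<omega> h = -\<infinity> \<longrightarrow>
            (\<forall>i\<in>pverts G. h i \<le> 0) \<and> \<not> (\<forall>i\<in>pverts G. h i = 0)) \<and>
         (c_minus G \<mu> \<omega> h > -\<infinity> \<longrightarrow>
            (\<exists>u. kazdan_warner_solution G \<mu> \<omega> h (real_of_ereal (c_minus G \<mu> \<omega> h)) u))"
proof -
  interpret weighted_graph G \<mu> \<omega>
    using assms(1-5) by (auto intro!: weighted_graph.intro weighted_graph_axioms.intro)
  \<comment> \<open>The total measure is positive, so the sign of the average is that of its
    numerator.\<close>
  have "(\<Sum>i\<in>V. \<mu> i) > 0"
    using finite_V V_nonempty measure_pos by (intro sum_pos) auto
  then have avg: "(\<Sum>i\<in>V. \<mu> i * h i) < 0"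
    using assms(6) by (simp add: graph_average_def divide_less_0_iff)
  let ?C = "c_minus G \<mu> \<omega> h"
  have "\<exists>!C. is_critical_constant G \<mu> \<omega> h C"
    using ex_critical_constant[OF avg] is_critical_constant_unique by blast
  then have crit: "is_critical_constant G \<mu> \<omega> h ?C"
    unfolding c_minus_def by (rule theI')
  have "(\<forall>i\<in>V. h i \<le> 0) \<and> \<not> (\<forall>i\<in>V. h i = 0)" if "?C = -\<infinity>"
  proof
    have "\<exists>u. kazdan_warner_solution G \<mu> \<omega> h c u" if "c < 0" for c
      using crit that \<open>?C = -\<infinity>\<close> by (simp add: is_critical_constant_def)
    then show "\<forall>i\<in>V. h i \<le> 0" using nonpos_if_kw_solvable by blast
    show "\<not> (\<forall>i\<in>V. h i = 0)"
    proof
      assume "\<forall>i\<in>V. h i = 0"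
      then have "(\<Sum>i\<in>V. \<mu> i * h i) = 0" by (intro sum.neutral) simp
      then show False using avg by simp
    qed
  qed
  moreover have "\<exists>u. kazdan_warner_solution G \<mu> \<omega> h (real_of_ereal ?C) u" if fin: "?C > -\<infinity>"
  proof -
    have "?C < 0" using crit by (simp add: is_critical_constant_def)
    then obtain C where C: "?C = ereal C" "C < 0"
      using fin by (cases ?C) auto
    show ?thesis
    \<comment> \<open>The compactness argument needs a vertex with \<open>h i > 0\<close>. If there
      is none, every negative constant is solvable, in particular \<open>C\<close>.\<close>
    proof (cases "\<forall>i\<in>V. h i \<le> 0")
      case True
      then show ?thesis using kw_solvable_if_nonpos[OF avg _ C(2)] C(1) by simp
    next
      case False
      then obtain i where "i \<in> V" "h i > 0" by (auto simp: not_le)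
      then show ?thesis using kw_solvable_at_critical[of h C i] crit C(1) by simp
    qed
  qed
  ultimately show ?thesis by blast
qed

end
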